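(* Let $b$ be a fixed prime, $m,s\in\mathbb{N}$, $N=b^m$, let $\alpha$ be a positive even integer, let $\gamma_1,\ldots,\gamma_s>0$ be product weights, and let $w_1\le\cdots\le w_s$ be non-negative integers. Let $s^\ast$ be the largest integer $j$ such that $w_j<m$. Then the cost (number of arithmetic operations) of the reduced fast CBC algorithm described in the context is $$O\left(b^m+\min\{s,s^\ast\}\,b^m+\sum_{d=1}^{\min\{s,s^\ast\}}(m-w_d)\,b^{m-w_d}\right).$$
   Context: The algorithm constructs the generating vector $(Y_1z_1,\ldots,Y_sz_s)$, $Y_j=b^{w_j}$, of a lattice rule with points $\{\frac{n}{N}(Y_1z_1,\ldots,Y_sz_s)\}$, $n=0,\ldots,N-1$ ($\{\cdot\}$ denotes fractional part), for integration in the weighted Korobov space with smoothness $\alpha$ and product weights $\gamma_{\mathfrak{u}}=\prod_{j\in\mathfrak{u}}\gamma_j$; the squared worst-case error in that space of the lattice rule generated by $(Y_1z_1,\ldots,Y_dz_d)$ is $-1+\frac1N\sum_{n=0}^{N-1}\prod_{j=1}^d\left[1+\gamma_j\varphi_\alpha\left(\left\{\frac{nY_jz_j}{N}\right\}\right)\right]$, where $$\varphi_\alpha(x)=\sum_{h\in\mathbb{Z}\setminus\{0\}}\frac{\exp(2\pi\mathrm{i}hx)}{|h|^\alpha}=\frac{(-1)^{(\alpha+2)/2}(2\pi)^\alpha}{\alpha!}B_\alpha(x),\quad x\in[0,1),$$ for even $\alpha$, with $B_\alpha$ the Bernoulli polynomial of degree $\alpha$. For $k\ge1$ let $\mathcal{Z}_{b^k,0}=\{z\in\{1,\ldots,b^k-1\}:\gcd(z,b)=1\}$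 and let $\Omega^{(k)}=\left(\varphi_\alpha\left(\left\{\frac{nz}{b^k}\right\}\right)\right)_{z\in\mathcal{Z}_{b^k,0},\,n=0,\ldots,b^k-1}$. Reduced fast CBC algorithm. Pre-computation: compute and store $\varphi_\alpha(n/b^m)$ for $n=0,\ldots,b^m-1$; set $z_1=1$ and $\eta_1(n)=1+\gamma_1\varphi_\alpha(\{nY_1z_1/b^m\})$ for $n=0,\ldots,b^m-1$; set $d=2$ and let $s^\ast$ be the largest integer $j$ with $w_j<m$ ($s^\ast=0$ if there is none). While $d\le\min\{s,s^\ast\}$: (1) partition the vector $\eta_{d-1}=(\eta_{d-1}(n))_{n=0}^{b^m-1}$ into $b^{w_d}$ consecutive vectors $\eta_{d-1}^{(1)},\ldots,\eta_{d-1}^{(b^{w_d})}$ of length $b^{m-w_d}$ and let $\eta'$ be their sum; (2) compute $T_d=(T_d(z))_{z\in\mathcal{Z}_{b^{m-w_d},0}}=\Omega^{(m-w_d)}\eta'$, using the fast (FFT-based) matrix-vector multiplication of Nuyens and Cools, which is known to multiply $\Omega^{(k)}$ with a vector of length $b^k$ in $O(kb^k)$ operations; (3) let $z_d=\mathrm{argmin}_zT_d(z)$; (4) let $\eta_d(n)=\eta_{d-1}(n)\left(1+\gamma_d\varphi_\alpha(\{nY_dz_d/b^m\})\right)$ for $n=0,\ldots,b^m-1$; (5) increase $d$ by $1$. If $s>s^\ast$, set $z_{s^\ast+1}=\cdots=z_s=0$; these components require no computation and are not counted in the cost, nor is the evaluation of the final worst-case error. The implied constant in $O$ may depend on the fixed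 $b$ and $\alpha$, but not on $m$, $s$, the $w_j$ or the $\gamma_j$. *)

theory Defs
  imports "HOL-Analysis.Analysis" "HOL-Library.Monad_Syntax"
    "HOL-Computational_Algebra.Primes"
begin

section \<open>Programs and their number of arithmetic operations\<close>

text \<open>
  Algorithms are adaptive straight-line programs over the reals. A program never sees a real number,
  only the address of the memory cell that holds it; reals are accessible solely through the
  instructions below. Each real instruction \<open>Const\<close>, \<open>Arith\<close> appends its result to the memory and
  passes the address of the new cell to the continuation. Every instruction costs one operation,
  namely
  loading a constant, an arithmetic operation, a comparison, and an operation on natural numbers
  (used for computing arguments such as \<open>n Y z mod N\<close>). Copying addresses, slicing vectors and
  loop control involve no arithmetic on data and are not counted.
\<close>

type_synonym addr = nat

datatype arith_op = Add | Sub | Mul | Div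
datatype nat_op = NAdd | NMul | NMod

primrec arith :: "arith_op \<Rightarrow> real \<Rightarrow> real \<Rightarrow> real" where
  "arith Add x y = x + y"
| "arith Sub x y = x - y"
| "arith Mul x y = x * y"
| "arith Div x y = x / y"

primrec nat_arith :: "nat_op \<Rightarrow> nat \<Rightarrow> nat \<Rightarrow> nat" where
  "nat_arith NAdd i j = i + j"
| "nat_arith NMul i j = i * j"
| "nat_arith NMod i j = i mod j"

datatype 'a prog =
    Return 'a
  | Const real "addr \<Rightarrow> 'a prog"
  | Arith arith_op addr addr "addr \<Rightarrow> 'a prog"
  | Less addr addr "bool \<Rightarrow> 'a prog"
  | Nat nat_op nat nat "nat \<Rightarrow> 'a prog"

type_synonym memory = "real list"

primrec result :: "'a prog \<Rightarrow> memory \<Rightarrow> 'a" where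
  "result (Return x) M = x"
| "result (Const c k) M = result (k (length M)) (M @ [c])"
| "result (Arith f i j k) M = result (k (length M)) (M @ [arith f (M ! i) (M ! j)])"
| "result (Less i j k) M = result (k (M ! i < M ! j)) M"
| "result (Nat f i j k) M = result (k (nat_arith f i j)) M"

primrec final_memory :: "'a prog \<Rightarrow> memory \<Rightarrow> memory" where
  "final_memory (Return x) M = M"
| "final_memory (Const c k) M = final_memory (k (length M)) (M @ [c])"
| "final_memory (Arith f i j k) M =
     final_memory (k (length M)) (M @ [arith f (M ! i) (M ! j)])"
| "final_memory (Less i j k) M = final_memory (k (M ! i < M ! j)) M"
| "final_memory (Nat f i j k) M = final_memory (k (nat_arith f i j)) M"

primrec cost :: "'a prog \<Rightarrow> memory \<Rightarrow> nat" where
  "cost (Return x) M = 0"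
| "cost (Const c k) M = 1 + cost (k (length M)) (M @ [c])"
| "cost (Arith f i j k) M = 1 + cost (k (length M)) (M @ [arith f (M ! i) (M ! j)])"
| "cost (Less i j k) M = 1 + cost (k (M ! i < M ! j)) M"
| "cost (Nat f i j k) M = 1 + cost (k (nat_arith f i j)) M"

primrec prog_bind :: "'a prog \<Rightarrow> ('a \<Rightarrow> 'b prog) \<Rightarrow> 'b prog" where
  "prog_bind (Return x) g = g x"
| "prog_bind (Const c k) g = Const c (\<lambda>r. prog_bind (k r) g)"
| "prog_bind (Arith f i j k) g = Arith f i j (\<lambda>r. prog_bind (k r) g)"
| "prog_bind (Less i j k) g = Less i j (\<lambda>r. prog_bind (k r) g)"
| "prog_bind (Nat f i j k) g = Nat f i j (\<lambda>r. prog_bind (k r) g)"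

adhoc_overloading Monad_Syntax.bind \<rightleftharpoons> prog_bind

abbreviation const :: "real \<Rightarrow> addr prog" where
  "const c \<equiv> Const c Return"

abbreviation real_op :: "arith_op \<Rightarrow> addr \<Rightarrow> addr \<Rightarrow> addr prog" where
  "real_op f i j \<equiv> Arith f i j Return"

abbreviation less :: "addr \<Rightarrow> addr \<Rightarrow> bool prog" where
  "less i j \<equiv> Less i j Return"

abbreviation index_op :: "nat_op \<Rightarrow> nat \<Rightarrow> nat \<Rightarrow> nat prog" where
  "index_op f i j \<equiv> Nat f i j Return"

primrec mapM :: "('a \<Rightarrow> 'b prog) \<Rightarrow> 'a list \<Rightarrow> 'b list prog" where
  "mapM f [] = Return []"
| "mapM f (x # xs) = do { y \<leftarrow> f x; ys \<leftarrow> mapM f xs; Return (y # ys) }"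

primrec foldM :: "('s \<Rightarrow> 'a \<Rightarrow> 's prog) \<Rightarrow> 's \<Rightarrow> 'a list \<Rightarrow> 's prog" where
  "foldM f s [] = Return s"
| "foldM f s (x # xs) = do { t \<leftarrow> f s x; foldM f t xs }"


section \<open>The kernel and the matrices of the component-by-component construction\<close>

text \<open>The series is real-valued for even \<open>\<alpha>\<close>, by symmetry in \<open>h\<close>.\<close>

definition phi :: "nat \<Rightarrow> real \<Rightarrow> real" where
  "phi \<alpha> x = Re (\<Sum>\<^sub>\<infinity>h\<in>UNIV - {0::int}.
     exp (2 * of_real pi * \<i> * of_int h * of_real x) / of_real (\<bar>of_int h\<bar> ^ \<alpha>))"

fun bernoulli_number :: "nat \<Rightarrow> real" where
  "bernoulli_number n = (if n = 0 then 1
     else - (\<Sum>k<n. of_nat (Suc n choose k) * bernoulli_number k) / (of_nat n + 1))"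

declare bernoulli_number.simps [simp del]

text \<open>
  Coefficients (constant term first) of
  \<open>(-1)^((\<alpha> + 2)/2) (2 \<pi>)^\<alpha> / \<alpha>! * B_\<alpha>(x)\<close>, where
  \<open>B_\<alpha>(x) = (\<Sum>i\<le>\<alpha>. (\<alpha> choose i) B_(\<alpha> - i) x^i)\<close>. For positive even
  \<open>\<alpha>\<close> this polynomial agrees with \<open>phi \<alpha>\<close> on \<open>[0,1)\<close>; it is what a program evaluates.
\<close>

definition phi_coeffs :: "nat \<Rightarrow> real list" where
  "phi_coeffs \<alpha> = map (\<lambda>i. (-1) ^ ((\<alpha> + 2) div 2) * (2 * pi) ^ \<alpha> / fact \<alpha> *
     (of_nat (\<alpha> choose i) * bernoulli_number (\<alpha> - i))) [0..<Suc \<alpha>]"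

text \<open>
  The admissible components \<open>{z \<in> {1,...,b^k - 1}. gcd(z, b) = 1}\<close> in increasing order; they index
  the rows of the matrix \<open>(\<phi>({n z / b^k}))\<close> with columns \<open>n = 0,...,b^k - 1\<close>.
\<close>

definition Z_list :: "nat \<Rightarrow> nat \<Rightarrow> nat list" where
  "Z_list b k = filter (\<lambda>z. gcd z b = 1) [1..<b ^ k]"

definition Omega :: "nat \<Rightarrow> nat \<Rightarrow> nat \<Rightarrow> nat \<Rightarrow> nat \<Rightarrow> real" where
  "Omega b \<alpha> k z n = phi \<alpha> (frac (real n * real z / real (b ^ k)))"

definition Omega_mult :: "nat \<Rightarrow> nat \<Rightarrow> nat \<Rightarrow> real list \<Rightarrow> real list" where
  "Omega_mult b \<alpha> k x = map (\<lambda>z. \<Sum>n<b ^ k. Omega b \<alpha> k z n * x ! n) (Z_list b k)"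

text \<open>
  \<open>mv k\<close> is a program that takes the addresses of the entries of a vector of length \<open>b^k\<close> and
  returns those of the entries of its product with \<open>\<Omega>\<close> of level \<open>k\<close>, in \<open>O(k b^k)\<close> operations;
  the implied constant is independent of \<open>k\<close> and of the vector.
\<close>

definition fast_Omega_mult ::
  "nat \<Rightarrow> nat \<Rightarrow> (nat \<Rightarrow> addr list \<Rightarrow> addr list prog) \<Rightarrow> bool" where
  "fast_Omega_mult b \<alpha> mv \<longleftrightarrow>
     (\<exists>C::real. \<forall>k\<ge>1. \<forall>M v. length v = b ^ k \<longrightarrow> set v \<subseteq> {..<length M} \<longrightarrow>
        set (result (mv k v) M) \<subseteq> {..<length (final_memory (mv k v) M)} \<and>
        map ((!) (final_memory (mv k v) M)) (result (mv k v) M)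
          = Omega_mult b \<alpha> k (map ((!) M) v) \<and>
        real (cost (mv k v) M) \<le> C * real k * real (b ^ k))"


section \<open>The reduced fast component-by-component algorithm\<close>

primrec horner :: "real list \<Rightarrow> addr \<Rightarrow> addr prog" where
  "horner [] x = const 0"
| "horner (c # cs) x = do {
     r \<leftarrow> horner cs x;
     r \<leftarrow> real_op Mul x r;
     a \<leftarrow> const c;
     real_op Add a r }"

definition phi_table :: "nat \<Rightarrow> nat \<Rightarrow> addr list prog" where
  "phi_table \<alpha> N = mapM (\<lambda>n. do {
     p \<leftarrow> const (real n);
     q \<leftarrow> const (real N);
     x \<leftarrow> real_op Div p q;
     horner (phi_coeffs \<alpha>) x }) [0..<N]"

text \<open>
  \<open>1 + \<gamma> \<phi>({n Y z / N})\<close>, where \<open>\<phi>({n Y z / N})\<close> is the stored value with index \<open>n Y z mod N\<close>.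
\<close>

definition factor :: "nat \<Rightarrow> addr list \<Rightarrow> addr \<Rightarrow> nat \<Rightarrow> nat \<Rightarrow> nat \<Rightarrow> addr prog" where
  "factor N tab \<gamma> Y z n = do {
     i \<leftarrow> index_op NMul n Y;
     i \<leftarrow> index_op NMul i z;
     i \<leftarrow> index_op NMod i N;
     t \<leftarrow> real_op Mul \<gamma> (tab ! i);
     one \<leftarrow> const 1;
     real_op Add one t }"

definition blocks :: "nat \<Rightarrow> nat \<Rightarrow> 'a list \<Rightarrow> 'a list list" where
  "blocks c l xs = map (\<lambda>j. take l (drop (j * l) xs)) [0..<c]"

definition add_vectors :: "addr list \<Rightarrow> addr list \<Rightarrow> addr list prog" where
  "add_vectors u v = mapM (\<lambda>(i, j). real_op Add i j) (zip u v)"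

definition sum_vectors :: "addr list list \<Rightarrow> addr list prog" where
  "sum_vectors vs = foldM add_vectors (hd vs) (tl vs)"

definition argmin :: "(nat \<times> addr) list \<Rightarrow> nat prog" where
  "argmin zts = do {
     best \<leftarrow> foldM (\<lambda>best zt. do {
       smaller \<leftarrow> less (snd zt) (snd best);
       Return (if smaller then zt else best) }) (hd zts) (tl zts);
     Return (fst best) }"

definition s_star :: "nat \<Rightarrow> nat \<Rightarrow> (nat \<Rightarrow> nat) \<Rightarrow> nat" where
  "s_star m s w = Max (insert 0 {j \<in> {1..s}. w j < m})"

text \<open>
  The state of the loop consists of the components chosen so far and of the addresses of the
  entries of \<open>\<eta>\<close>. The weights are the input: the cell with address \<open>d - 1\<close> holds \<open>\<gamma> d\<close>.
\<close>

definition cbc_step ::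
  "nat \<Rightarrow> (nat \<Rightarrow> addr list \<Rightarrow> addr list prog) \<Rightarrow> nat \<Rightarrow> (nat \<Rightarrow> nat) \<Rightarrow> addr list \<Rightarrow>
   nat list \<times> addr list \<Rightarrow> nat \<Rightarrow> (nat list \<times> addr list) prog" where
  "cbc_step b mv m w tab = (\<lambda>(zs, \<eta>) d. do {
     \<eta>' \<leftarrow> sum_vectors (blocks (b ^ w d) (b ^ (m - w d)) \<eta>);
     T \<leftarrow> mv (m - w d) \<eta>';
     z \<leftarrow> argmin (zip (Z_list b (m - w d)) T);
     \<eta> \<leftarrow> mapM (\<lambda>n. do {
       f \<leftarrow> factor (b ^ m) tab (d - 1) (b ^ w d) z n;
       real_op Mul (\<eta> ! n) f }) [0..<b ^ m];
     Return (zs @ [z], \<eta>) })"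

definition reduced_fast_cbc ::
  "nat \<Rightarrow> nat \<Rightarrow> (nat \<Rightarrow> addr list \<Rightarrow> addr list prog) \<Rightarrow> nat \<Rightarrow> nat \<Rightarrow> (nat \<Rightarrow> nat) \<Rightarrow>
   nat list prog" where
  "reduced_fast_cbc b \<alpha> mv m s w = do {
     tab \<leftarrow> phi_table \<alpha> (b ^ m);
     \<eta> \<leftarrow> mapM (factor (b ^ m) tab 0 (b ^ w 1) 1) [0..<b ^ m];
     (zs, \<eta>) \<leftarrow> foldM (cbc_step b mv m w tab) ([1], \<eta>) [2..<Suc (min s (s_star m s w))];
     Return (take (s_star m s w) zs @ replicate (s - s_star m s w) 0) }"

end

theory Submission
  imports Defs
begin

text \<open>
  With \<open>N = b^m\<close>, tabulating the kernel by Horner's rule and initialising \<open>\<eta>\<close> take \<open>O(N)\<close>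
  operations. In iteration \<open>d\<close>, adding the \<open>b^(w d)\<close> blocks of length \<open>b^(m - w d)\<close> touches each
  of the \<open>N\<close> entries of \<open>\<eta>\<close> at most once, the minimisation takes at most \<open>b^(m - w d)\<close>
  comparisons and the update of \<open>\<eta>\<close> seven operations per entry, so that everything except the
  matrix-vector product is \<open>O(N)\<close>. Since \<open>w\<close> is monotone, every iterated \<open>d\<close> has \<open>w d < m\<close>;
  hence the blocks tile \<open>\<eta>\<close> exactly and the fast product applies at level \<open>m - w d \<ge> 1\<close>.
\<close>

section \<open>Semantics and cost bounds of composed programs\<close>

lemma result_prog_bind [simp]:
  "result (prog_bind p f) M = result (f (result p M)) (final_memory p M)"
  by (induction p arbitrary: M) auto

lemma final_memory_prog_bind [simp]:
  "final_memory (prog_bind p f) M = final_memory (f (result p M)) (final_memory p M)"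
  by (induction p arbitrary: M) auto

lemma cost_prog_bind [simp]:
  "cost (prog_bind p f) M = cost p M + cost (f (result p M)) (final_memory p M)"
  by (induction p arbitrary: M) auto

text \<open>Memory is append-only: \<open>Const\<close> and \<open>Arith\<close> add one cell, the
  other instructions add none. Hence an address that is valid once stays valid.\<close>

lemma length_final_memory: "length M \<le> length (final_memory p M)"
proof (induction p arbitrary: M)
  case (Const c k)
  show ?case using Const[OF rangeI, of "M @ [c]" "length M"] by simp
next
  case (Arith f i j k)
  show ?case using Arith[OF rangeI, of "M @ [arith f (M ! i) (M ! j)]" "length M"] by simp
qed auto

text \<open>
  Postconditions see the memory only through its length, which is all that the validity of
  addresses, and hence the applicability of the cost bound for \<open>mv\<close>, depends on.
\<close>

definition bounded_run ::
  "'a prog \<Rightarrow> memory \<Rightarrow> nat \<Rightarrow> ('a \<Rightarrow> nat \<Rightarrow> bool) \<Rightarrow> bool" where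
  "bounded_run p M c Q \<longleftrightarrow> cost p M \<le> c \<and> Q (result p M) (length (final_memory p M))"

lemma bounded_run_weaken:
  assumes "bounded_run p M c Q" and "c \<le> c'"
    and "\<And>x l. length M \<le> l \<Longrightarrow> Q x l \<Longrightarrow> Q' x l"
  shows "bounded_run p M c' Q'"
  using assms length_final_memory[of M p] by (auto simp: bounded_run_def)

lemma bounded_run_Return [simp]: "bounded_run (Return x) M c Q \<longleftrightarrow> Q x (length M)"
  by (simp add: bounded_run_def)

text \<open>The continuation is bounded for every memory \<open>M'\<close> of admissible length,
  whatever its contents; this covers comparisons, whose outcome depends on the stored reals.\<close>

lemma bounded_run_bind:
  assumes "bounded_run p M c Q"
    and "\<And>x M'. length M \<le> length M' \<Longrightarrow> Q x (length M') \<Longrightarrow> bounded_run (f x) M' c' R"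
  shows "bounded_run (prog_bind p f) M (c + c') R"
  using assms(1) assms(2)[of "final_memory p M" "result p M"] length_final_memory[of M p]
  by (auto simp: bounded_run_def)

text \<open>As a postcondition, \<open>(<)\<close> says that the returned address lies inside the
  final memory. Later runs never shrink the memory, so all collected addresses remain valid.\<close>

lemma bounded_run_mapM:
  assumes "\<And>x M'. x \<in> set xs \<Longrightarrow> length M \<le> length M' \<Longrightarrow> bounded_run (f x) M' c (<)"
  shows "bounded_run (mapM f xs) M (length xs * c)
    (\<lambda>ys l. length ys = length xs \<and> set ys \<subseteq> {..<l})"
  using assms
proof (induction xs arbitrary: M)
  case Nil
  show ?case by simp
next
  case (Cons x xs)
  have "bounded_run (mapM f (x # xs)) M (c + (length xs * c + 0))
    (\<lambda>ys l. length ys = length (x # xs) \<and> set ys \<subseteq> {..<l})"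
    unfolding mapM.simps
  proof (rule bounded_run_bind)
    show "bounded_run (f x) M c (<)"
      by (simp add: Cons.prems)
  next
    fix y and M' :: memory
    assume y: "length M \<le> length M'" "y < length M'"
    have "bounded_run (mapM f xs) M' (length xs * c)
      (\<lambda>ys l. length ys = length xs \<and> set ys \<subseteq> {..<l})"
      using y by (intro Cons.IH Cons.prems) auto
    then show "bounded_run (prog_bind (mapM f xs) (\<lambda>ys. Return (y # ys))) M' (length xs * c + 0)
      (\<lambda>ys l. length ys = length (x # xs) \<and> set ys \<subseteq> {..<l})"
      by (rule bounded_run_bind) (use y in auto)
  qed
  then show ?case by simp
qed

text \<open>\<open>I\<close> is a loop invariant. The budget \<open>c x\<close> may vary with the
  list element but not with the state, so the total is the same whichever components get
  chosen.\<close>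

lemma bounded_run_foldM:
  assumes "\<And>s x M'. x \<in> set xs \<Longrightarrow> I s (length M') \<Longrightarrow> bounded_run (f s x) M' (c x) I"
    and "I s (length M)"
  shows "bounded_run (foldM f s xs) M (\<Sum>x\<leftarrow>xs. c x) I"
  using assms
proof (induction xs arbitrary: s M)
  case Nil
  then show ?case by simp
next
  case (Cons x xs)
  have "bounded_run (f s x) M (c x) I"
    by (simp add: Cons.prems)
  then have "bounded_run (prog_bind (f s x) (\<lambda>t. foldM f t xs)) M (c x + (\<Sum>x\<leftarrow>xs. c x)) I"
    by (rule bounded_run_bind) (use Cons in auto)
  then show ?case by simp
qed

section \<open>Costs of the subroutines\<close>

lemma bounded_run_horner: "bounded_run (horner cs x) M (3 * length cs + 1) (<)"
proof (induction cs)
  case Nil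
  show ?case by (simp add: bounded_run_def)
next
  case (Cons c cs)
  \<comment> \<open>Three instructions per coefficient: a product, a constant and a sum. The empty
    list costs one constant.\<close>
  have "bounded_run (horner (c # cs) x) M ((3 * length cs + 1) + 3) (<)"
    unfolding horner.simps
    by (rule bounded_run_bind[OF Cons]) (simp add: bounded_run_def)
  then show ?case by (simp add: algebra_simps)
qed

lemma bounded_run_phi_table:
  "bounded_run (phi_table \<alpha> N) M (N * (3 * \<alpha> + 7)) (\<lambda>tab l. length tab = N \<and> set tab \<subseteq> {..<l})"
proof -
  \<comment> \<open>There are \<alpha> + 1 coefficients, so Horner's rule takes at most 3 \<alpha> +
    4 instructions; two constants and a division precede it.\<close>
  have "bounded_run (do {
     p \<leftarrow> const (real n);
     q \<leftarrow> const (real N);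
     x \<leftarrow> real_op Div p q;
     horner (phi_coeffs \<alpha>) x }) M' (3 * \<alpha> + 7) (<)" for n M'
    using bounded_run_horner[of "phi_coeffs \<alpha>"]
    by (simp add: bounded_run_def phi_coeffs_def)
  from bounded_run_mapM[of "[0..<N]", OF this] show ?thesis
    by (simp add: phi_table_def)
qed

lemma bounded_run_factor: "bounded_run (factor N tab g Y z n) M 6 (<)"
  by (simp add: bounded_run_def factor_def)

lemma bounded_run_add_vectors:
  assumes "length u = n" and "length v = n"
  shows "bounded_run (add_vectors u v) M n (\<lambda>r l. length r = n \<and> set r \<subseteq> {..<l})"
proof -
  have "bounded_run ((\<lambda>(i, j). real_op Add i j) x) M' 1 (<)" for x M'
    by (cases x) (simp add: bounded_run_def)
  from bounded_run_mapM[of "zip u v", OF this] show ?thesis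
    using assms by (simp add: add_vectors_def)
qed

lemma length_blocks [simp]: "length (blocks c n xs) = c"
  by (simp add: blocks_def)

lemma length_in_blocks:
  assumes "v \<in> set (blocks c n xs)" and "length xs = c * n"
  shows "length v = n"
proof -
  obtain j where j: "j < c" and v: "v = take n (drop (j * n) xs)"
    using assms(1) by (auto simp: blocks_def)
  \<comment> \<open>Block \<open>j\<close> ends at position \<open>Suc j * n\<close>, still within
    \<open>xs\<close>, so \<open>take\<close> finds \<open>n\<close> entries.\<close>
  have "Suc j * n \<le> c * n"
    using j by (intro mult_le_mono1) simp
  then show ?thesis
    using v assms(2) by simp
qed

lemma set_in_blocks: "v \<in> set (blocks c n xs) \<Longrightarrow> set v \<subseteq> set xs"
  by (auto simp: blocks_def dest!: in_set_takeD in_set_dropD)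

text \<open>The first block is the initial accumulator. With a single block its own addresses are
  returned, whence the validity condition on the input.\<close>

lemma bounded_run_sum_vectors:
  assumes "vs \<noteq> []" and "\<And>v. v \<in> set vs \<Longrightarrow> length v = n \<and> set v \<subseteq> {..<length M}"
  shows "bounded_run (sum_vectors vs) M (length vs * n) (\<lambda>r l. length r = n \<and> set r \<subseteq> {..<l})"
proof -
  have "bounded_run (sum_vectors vs) M (\<Sum>v\<leftarrow>tl vs. n)
    (\<lambda>r l. length r = n \<and> set r \<subseteq> {..<l})"
    unfolding sum_vectors_def
  proof (rule bounded_run_foldM)
    fix u v and M' :: memory
    assume "v \<in> set (tl vs)" and "length u = n \<and> set u \<subseteq> {..<length M'}"
    then show "bounded_run (add_vectors u v) M' n (\<lambda>r l. length r = n \<and> set r \<subseteq> {..<l})"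
      using assms by (intro bounded_run_add_vectors) (auto dest: list.set_sel(2))
  next
    show "length (hd vs) = n \<and> set (hd vs) \<subseteq> {..<length M}"
      using assms by simp
  qed
  then show ?thesis
    by (rule bounded_run_weaken) (auto simp: sum_list_triv)
qed

text \<open>One comparison per candidate after the first. The outcome is a number and not an
  address, so a trivial postcondition suffices.\<close>

lemma bounded_run_argmin: "bounded_run (argmin zts) M (length zts) (\<lambda>_ _. True)"
proof -
  let ?f = "\<lambda>best zt. do {
     smaller \<leftarrow> less (snd zt) (snd best);
     Return (if smaller then zt else best) }"
  have "bounded_run (foldM ?f (hd zts) (tl zts)) M (\<Sum>_\<leftarrow>tl zts. 1) (\<lambda>_ _. True)"
    by (rule bounded_run_foldM) (auto simp: bounded_run_def)
  then have "bounded_run (argmin zts) M ((\<Sum>_\<leftarrow>tl zts. 1) + 0) (\<lambda>_ _. True)"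
    unfolding argmin_def by (rule bounded_run_bind) simp
  then show ?thesis
    by (rule bounded_run_weaken) (auto simp: sum_list_triv)
qed

lemma length_Z_list_le: "length (Z_list b k) \<le> b ^ k"
  using length_filter_le[of "\<lambda>z. gcd z b = 1" "[1..<b ^ k]"] by (simp add: Z_list_def)

text \<open>Rounding \<open>C\<close> up gives a natural constant, 0 if \<open>C\<close> is
  negative. The product only feeds the minimisation, whose cost bound holds for arbitrary addresses,
  so a trivial postcondition is enough.\<close>

lemma fast_Omega_mult_bounded_run:
  assumes "fast_Omega_mult b \<alpha> mv"
  obtains D where "\<And>k v M. k \<ge> 1 \<Longrightarrow> length v = b ^ k \<Longrightarrow> set v \<subseteq> {..<length M} \<Longrightarrow>
    bounded_run (mv k v) M (D * (k * b ^ k)) (\<lambda>_ _. True)"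
proof -
  from assms obtain C :: real where C: "\<And>k v M. k \<ge> 1 \<Longrightarrow> length v = b ^ k \<Longrightarrow>
    set v \<subseteq> {..<length M} \<Longrightarrow> real (cost (mv k v) M) \<le> C * real k * real (b ^ k)"
    unfolding fast_Omega_mult_def by blast
  have "bounded_run (mv k v) M (nat \<lceil>C\<rceil> * (k * b ^ k)) (\<lambda>_ _. True)"
    if "k \<ge> 1" "length v = b ^ k" "set v \<subseteq> {..<length M}" for k v M
  proof -
    have "real (cost (mv k v) M) \<le> C * real (k * b ^ k)"
      using C[OF that] by (simp add: mult.assoc)
    also have "\<dots> \<le> real (nat \<lceil>C\<rceil>) * real (k * b ^ k)"
      by (intro mult_right_mono real_nat_ceiling_ge of_nat_0_le_iff)
    finally have "cost (mv k v) M \<le> nat \<lceil>C\<rceil> * (k * b ^ k)"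
      by (metis of_nat_le_iff of_nat_mult)
    then show ?thesis by (simp add: bounded_run_def)
  qed
  then show ?thesis by (rule that)
qed

section \<open>One iteration of the loop\<close>

lemma bounded_run_cbc_step:
  assumes "b > 0" and w: "w d < m"
    and mv: "\<And>k v M. k \<ge> 1 \<Longrightarrow> length v = b ^ k \<Longrightarrow> set v \<subseteq> {..<length M} \<Longrightarrow>
      bounded_run (mv k v) M (D * (k * b ^ k)) (\<lambda>_ _. True)"
    and \<eta>: "length \<eta> = b ^ m" "set \<eta> \<subseteq> {..<length M}"
  shows "bounded_run (cbc_step b mv m w tab (zs, \<eta>) d) M
    (9 * b ^ m + D * ((m - w d) * b ^ (m - w d)))
    (\<lambda>st l. length (snd st) = b ^ m \<and> set (snd st) \<subseteq> {..<l})"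
proof -
  let ?k = "m - w d"
  let ?vs = "blocks (b ^ w d) (b ^ ?k) \<eta>"
  have bm: "b ^ w d * b ^ ?k = b ^ m"
    using w by (simp flip: power_add)
  have "?vs \<noteq> []"
    using \<open>b > 0\<close> by (simp flip: length_greater_0_conv)
  then have sum: "bounded_run (sum_vectors ?vs) M (b ^ m)
    (\<lambda>r l. length r = b ^ ?k \<and> set r \<subseteq> {..<l})"
    using bounded_run_sum_vectors[of ?vs "b ^ ?k" M] length_in_blocks[of _ "b ^ w d" "b ^ ?k" \<eta>]
      set_in_blocks[of _ "b ^ w d" "b ^ ?k" \<eta>] \<eta>
    by (fastforce simp: bm)
  have argmin: "bounded_run (argmin (zip (Z_list b ?k) T)) M' (b ^ m) (\<lambda>_ _. True)" for T M'
  proof (rule bounded_run_weaken[OF bounded_run_argmin])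
    have "length (zip (Z_list b ?k) T) \<le> b ^ ?k"
      using length_Z_list_le[of b ?k] by simp
    also have "\<dots> \<le> b ^ m"
      using \<open>b > 0\<close> by (intro power_increasing) auto
    finally show "length (zip (Z_list b ?k) T) \<le> b ^ m" .
  qed simp
  have entry: "bounded_run (prog_bind (factor (b ^ m) tab (d - 1) (b ^ w d) z n)
    (real_op Mul (\<eta> ! n))) M' 7 (<)" for z n M'
    using bounded_run_bind[OF bounded_run_factor,
        where f = "real_op Mul (\<eta> ! n)" and c' = 1 and R = "(<)"]
    by (simp add: bounded_run_def)
  have update: "bounded_run (mapM (\<lambda>n. prog_bind (factor (b ^ m) tab (d - 1) (b ^ w d) z n)
    (real_op Mul (\<eta> ! n))) [0..<b ^ m]) M' (b ^ m * 7)
    (\<lambda>r l. length r = b ^ m \<and> set r \<subseteq> {..<l})" for z M'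
    using bounded_run_mapM[of "[0..<b ^ m]", OF entry] by simp
  \<comment> \<open>The coefficient 9 collects 1 for the block sum, 1 for the minimisation and 7 for
    the update.\<close>
  have "bounded_run (cbc_step b mv m w tab (zs, \<eta>) d) M
    (b ^ m + (D * (?k * b ^ ?k) + (b ^ m + (b ^ m * 7 + 0))))
    (\<lambda>st l. length (snd st) = b ^ m \<and> set (snd st) \<subseteq> {..<l})"
    unfolding cbc_step_def prod.case
    by (rule bounded_run_bind[OF sum] bounded_run_bind[OF mv] bounded_run_bind[OF argmin]
        bounded_run_bind[OF update] | use w in simp)+
  then show ?thesis
    by (rule bounded_run_weaken) auto
qed

section \<open>Range of the loop and total cost\<close>

lemma w_less_if_le_s_star:
  assumes "mono_on {1..s} w" and "1 \<le> d" and "d \<le> s_star m s w"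
  shows "w d < m"
proof -
  \<comment> \<open>The maximum is attained, and 1 \<le> d excludes the default 0; monotonicity then
    passes the inequality down to \<open>d\<close>.\<close>
  have "s_star m s w \<in> insert 0 {j \<in> {1..s}. w j < m}"
    unfolding s_star_def by (rule Max_in) auto
  with assms(2,3) have "s_star m s w \<in> {1..s}" and "w (s_star m s w) < m"
    by auto
  with assms show ?thesis
    using mono_onD[OF assms(1), of d "s_star m s w"] by auto
qed

lemma bounded_run_reduced_fast_cbc:
  assumes "b > 0" and w: "mono_on {1..s} w"
    and mv: "\<And>k v M. k \<ge> 1 \<Longrightarrow> length v = b ^ k \<Longrightarrow> set v \<subseteq> {..<length M} \<Longrightarrow>
      bounded_run (mv k v) M (D * (k * b ^ k)) (\<lambda>_ _. True)"
  shows "bounded_run (reduced_fast_cbc b \<alpha> mv m s w) M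
    ((3 * \<alpha> + 13) * b ^ m + (\<Sum>d = 1..min s (s_star m s w).
        9 * b ^ m + D * ((m - w d) * b ^ (m - w d))))
    (\<lambda>_ _. True)"
proof -
  let ?r = "min s (s_star m s w)"
  let ?c = "\<lambda>d. 9 * b ^ m + D * ((m - w d) * b ^ (m - w d))"
  have init: "bounded_run (mapM (factor (b ^ m) tab 0 (b ^ w 1) 1) [0..<b ^ m]) M' (b ^ m * 6)
    (\<lambda>\<eta> l. length \<eta> = b ^ m \<and> set \<eta> \<subseteq> {..<l})" for tab M'
    using bounded_run_mapM[of "[0..<b ^ m]", OF bounded_run_factor] by simp
  have loop: "bounded_run (foldM (cbc_step b mv m w tab) ([1], \<eta>) [2..<Suc ?r]) M'
      (\<Sum>d\<leftarrow>[2..<Suc ?r]. ?c d) (\<lambda>st l. length (snd st) = b ^ m \<and> set (snd st) \<subseteq> {..<l})"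
    if "length \<eta> = b ^ m \<and> set \<eta> \<subseteq> {..<length M'}" for tab \<eta> M'
  proof (rule bounded_run_foldM)
    fix st :: "nat list \<times> addr list" and d and M' :: memory
    assume d: "d \<in> set [2..<Suc ?r]"
      and st: "length (snd st) = b ^ m \<and> set (snd st) \<subseteq> {..<length M'}"
    have "w d < m"
      using d by (intro w_less_if_le_s_star[OF w]) auto
    from bounded_run_cbc_step[where w = w and d = d and \<eta> = "snd st" and zs = "fst st",
        OF \<open>b > 0\<close> this mv] st
    show "bounded_run (cbc_step b mv m w tab st d) M' (?c d)
      (\<lambda>st l. length (snd st) = b ^ m \<and> set (snd st) \<subseteq> {..<l})"
      by simp
  qed (use that in simp)
  \<comment> \<open>Table and initial \<eta> run even if the loop is empty, hence the separate
    summand with factor (3 \<alpha> + 7) + 6.\<close>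
  have "bounded_run (reduced_fast_cbc b \<alpha> mv m s w) M
    (b ^ m * (3 * \<alpha> + 7) + (b ^ m * 6 + ((\<Sum>d\<leftarrow>[2..<Suc ?r]. ?c d) + 0))) (\<lambda>_ _. True)"
    unfolding reduced_fast_cbc_def
    by (rule bounded_run_bind[OF bounded_run_phi_table] bounded_run_bind[OF init]
        bounded_run_bind[OF loop] | simp add: case_prod_beta)+
  then show ?thesis
  proof (rule bounded_run_weaken)
    have "(\<Sum>d\<leftarrow>[2..<Suc ?r]. ?c d) = (\<Sum>d\<in>{2..<Suc ?r}. ?c d)"
      by (simp only: interv_sum_list_conv_sum_set_nat set_upt)
    \<comment> \<open>The loop starts at 2, as the first component is fixed; including
      \<open>d = 1\<close> only enlarges the sum.\<close>
    also have "\<dots> \<le> (\<Sum>d = 1..?r. ?c d)"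
      by (intro sum_mono2) auto
    finally show "b ^ m * (3 * \<alpha> + 7) + (b ^ m * 6 + ((\<Sum>d\<leftarrow>[2..<Suc ?r]. ?c d) + 0))
      \<le> (3 * \<alpha> + 13) * b ^ m + (\<Sum>d = 1..?r. ?c d)"
      by (simp add: algebra_simps)
  qed simp
qed

theorem theorem2:
  fixes b \<alpha> :: nat
    and mv :: "nat \<Rightarrow> addr list \<Rightarrow> addr list prog"
  assumes "prime b"
    and "\<alpha> > 0" and "even \<alpha>"
    and "fast_Omega_mult b \<alpha> mv"
  shows "\<exists>K>0. \<forall>(m::nat) (s::nat) (w :: nat \<Rightarrow> nat) (\<gamma> :: nat \<Rightarrow> real).
    m \<ge> 1 \<longrightarrow> s \<ge> 1 \<longrightarrow>
    (\<forall>j\<in>{1..s}. \<gamma> j > 0) \<longrightarrow>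
    mono_on {1..s} w \<longrightarrow>
    real (cost (reduced_fast_cbc b \<alpha> mv m s w) (map \<gamma> [1..<Suc s]))
      \<le> K * (real (b ^ m) + real (min s (s_star m s w)) * real (b ^ m)
           + (\<Sum>d = 1..min s (s_star m s w). real (m - w d) * real (b ^ (m - w d))))"
proof -
  have "b > 0"
    using \<open>prime b\<close> by (rule prime_gt_0_nat)
  obtain D where mv: "\<And>k v M. k \<ge> 1 \<Longrightarrow> length v = b ^ k \<Longrightarrow> set v \<subseteq> {..<length M} \<Longrightarrow>
    bounded_run (mv k v) M (D * (k * b ^ k)) (\<lambda>_ _. True)"
    using fast_Omega_mult_bounded_run[OF assms(4)] by blast
  \<comment> \<open>Dominates the coefficients 3 \<alpha> + 13, 9 and \<open>D\<close> of the three
    summands, and is fixed before \<open>m\<close>, \<open>s\<close>, \<open>w\<close> and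
    \<gamma>.\<close>
  let ?K = "3 * \<alpha> + 13 + D"
  have "real (cost (reduced_fast_cbc b \<alpha> mv m s w) (map \<gamma> [1..<Suc s]))
      \<le> real ?K * (real (b ^ m) + real (min s (s_star m s w)) * real (b ^ m)
           + (\<Sum>d = 1..min s (s_star m s w). real (m - w d) * real (b ^ (m - w d))))"
    if "mono_on {1..s} w" for m s :: nat and w :: "nat \<Rightarrow> nat" and \<gamma> :: "nat \<Rightarrow> real"
  proof -
    let ?r = "min s (s_star m s w)"
    let ?S = "\<Sum>d = 1..?r. (m - w d) * b ^ (m - w d)"
    have "cost (reduced_fast_cbc b \<alpha> mv m s w) (map \<gamma> [1..<Suc s])
        \<le> (3 * \<alpha> + 13) * b ^ m + (\<Sum>d = 1..?r. 9 * b ^ m + D * ((m - w d) * b ^ (m - w d)))"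
      using bounded_run_reduced_fast_cbc[OF \<open>b > 0\<close> that mv] by (simp add: bounded_run_def)
    also have "\<dots> = (3 * \<alpha> + 13) * b ^ m + 9 * (?r * b ^ m) + D * ?S"
      by (simp add: sum.distrib sum_distrib_left)
    also have "\<dots> \<le> ?K * b ^ m + ?K * (?r * b ^ m) + ?K * ?S"
      by (rule add_mono, rule add_mono; rule mult_le_mono1; simp)
    also have "\<dots> = ?K * (b ^ m + ?r * b ^ m + ?S)"
      by (simp only: distrib_left)
    finally have "real (cost (reduced_fast_cbc b \<alpha> mv m s w) (map \<gamma> [1..<Suc s]))
        \<le> real (?K * (b ^ m + ?r * b ^ m + ?S))"
      by (simp only: of_nat_le_iff)
    then show ?thesis
      by (simp only: of_nat_mult of_nat_add of_nat_sum)
  qed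
  then show ?thesis
    by (intro exI[of _ "real ?K"] conjI allI impI) (simp, blast)
qed

end
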